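(* Let $\gamma$ be a composition of $n$. Then the coproduct of the quasisymmetric powersum $P_\gamma$ in $\mathrm{QSym}$ is $$\Delta(P_\gamma)=\sum_{\alpha|\beta=\gamma}\ \prod_{i=1}^n\frac{m_i(\gamma)!}{m_i(\alpha)!\,m_i(\beta)!}\;P_\alpha\otimes P_\beta,$$ where the sum is over all pairs of (possibly empty) compositions $(\alpha,\beta)$ whose concatenation is $\gamma$.
   Context: A composition is a finite (possibly empty) sequence of positive integers; $\alpha|\beta$ denotes concatenation; $m_i(\alpha)$ is the number of parts of $\alpha$ equal to $i$. For compositions $\alpha,\beta$ of the same integer, $\alpha\le\beta$ means that $\beta$ is obtained from $\alpha$ by summing groups of consecutive parts (i.e. $\alpha$ refines $\beta$). $\mathrm{QSym}$ is the Hopf algebra (over $\mathbb{Q}$) of quasisymmetric functions in $x_1,x_2,\dots$, with monomial basis $M_\alpha=\sum_{i_1<\cdots<i_k}x_{i_1}^{a_1}\cdots x_{i_k}^{a_k}$ for $\alpha=(a_1,\dots,a_k)$ and $M_\emptyset=1$; its coproduct is $\Delta(M_\gamma)=\sum_{\alpha|\beta=\gamma}M_\alpha\otimes M_\beta$. If $\alpha\le\beta=(b_1,\dots,b_l)$, write uniquely $\alpha=\alpha^{(1)}|\cdots|\alpha^{(l)}$ with $\alpha^{(j)}$ a composition of $b_j$, and put $c_i(\alpha,\beta)!=\prod_{j=1}^l m_i(\alpha^{(j)})!$ and $C_{\alpha\beta}=\prod_{i\ge1}\frac{m_i(\alpha)!}{c_i(\alpha,\beta)!}$. Let $C(\alpha)$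 be the composition obtained from $\alpha=(a_1,\dots,a_k)$ by breaking it at every strict ascent $a_i<a_{i+1}$ and replacing each resulting (maximal weakly decreasing) run of consecutive parts by its sum; e.g. $C(3,2,1,1,3,1,1,1,2,1)=(7,6,3)$. The (descending) quasisymmetric powersum function is $$P_\alpha=\sum_{\alpha\le\beta\le C(\alpha)}C_{\alpha\beta}M_\beta ,\qquad P_\emptyset=1.$$ *)

theory Defs
  imports Complex_Main "HOL-Library.Poly_Mapping"
begin

section \<open>Vector spaces over the rationals\<close>

class rat_vector = ab_group_add +
  fixes scaleQ :: "rat \<Rightarrow> 'a \<Rightarrow> 'a" (infixr "*\<^sub>Q" 75)
  assumes scaleQ_add_right: "a *\<^sub>Q (x + y) = a *\<^sub>Q x + a *\<^sub>Q y"
    and scaleQ_add_left: "(a + b) *\<^sub>Q x = a *\<^sub>Q x + b *\<^sub>Q x"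
    and scaleQ_scaleQ: "a *\<^sub>Q b *\<^sub>Q x = (a * b) *\<^sub>Q x"
    and scaleQ_one: "1 *\<^sub>Q x = x"

global_interpretation rat_vector: vector_space "scaleQ :: rat \<Rightarrow> 'a \<Rightarrow> 'a :: rat_vector"
  by unfold_locales (simp_all add: scaleQ_add_right scaleQ_add_left scaleQ_scaleQ scaleQ_one)

instantiation rat :: rat_vector
begin
definition "scaleQ = ((*) :: rat \<Rightarrow> rat \<Rightarrow> rat)"
instance by standard (simp_all add: scaleQ_rat_def algebra_simps)
end

instantiation poly_mapping :: (type, rat_vector) rat_vector
begin
lift_definition scaleQ_poly_mapping :: "rat \<Rightarrow> ('a \<Rightarrow>\<^sub>0 'b) \<Rightarrow> 'a \<Rightarrow>\<^sub>0 'b"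
  is "\<lambda>c f x. c *\<^sub>Q f x"
  by (erule rev_finite_subset) auto
instance
  by standard (transfer; simp add: fun_eq_iff scaleQ_add_right scaleQ_add_left scaleQ_scaleQ scaleQ_one)+
end


section \<open>The tensor product over the rationals\<close>

text \<open>
  The free rational vector space on the set of pairs, modulo the subspace spanned by the
  relations that make the class of a pair bilinear in its two components.
\<close>

definition tensor_relations :: "(('a :: rat_vector \<times> 'b :: rat_vector) \<Rightarrow>\<^sub>0 rat) set" where
  "tensor_relations =
     {Poly_Mapping.single (x + x', y) 1 - Poly_Mapping.single (x, y) 1
        - Poly_Mapping.single (x', y) 1 | x x' y. True} \<union>
     {Poly_Mapping.single (x, y + y') 1 - Poly_Mapping.single (x, y) 1
        - Poly_Mapping.single (x, y') 1 | x y y'. True} \<union>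
     {Poly_Mapping.single (c *\<^sub>Q x, y) 1 - c *\<^sub>Q Poly_Mapping.single (x, y) 1 | c x y. True} \<union>
     {Poly_Mapping.single (x, c *\<^sub>Q y) 1 - c *\<^sub>Q Poly_Mapping.single (x, y) 1 | c x y. True}"

definition tensor_equiv ::
    "(('a :: rat_vector \<times> 'b :: rat_vector) \<Rightarrow>\<^sub>0 rat) \<Rightarrow> ('a \<times> 'b \<Rightarrow>\<^sub>0 rat) \<Rightarrow> bool" where
  "tensor_equiv s t \<longleftrightarrow> s - t \<in> rat_vector.span tensor_relations"

lemma equivp_tensor_equiv:
  "equivp (tensor_equiv :: ('a :: rat_vector \<times> 'b :: rat_vector \<Rightarrow>\<^sub>0 rat) \<Rightarrow> _)"
proof (rule equivpI)
  show "reflp (tensor_equiv :: ('a \<times> 'b \<Rightarrow>\<^sub>0 rat) \<Rightarrow> _)"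
    by (auto simp: reflp_def tensor_equiv_def rat_vector.span_zero)
  show "symp (tensor_equiv :: ('a \<times> 'b \<Rightarrow>\<^sub>0 rat) \<Rightarrow> _)"
    unfolding symp_def tensor_equiv_def
    by (metis minus_diff_eq rat_vector.span_neg)
  show "transp (tensor_equiv :: ('a \<times> 'b \<Rightarrow>\<^sub>0 rat) \<Rightarrow> _)"
    unfolding transp_def tensor_equiv_def
  proof (intro allI impI)
    fix s t u :: "'a \<times> 'b \<Rightarrow>\<^sub>0 rat"
    assume "s - t \<in> rat_vector.span tensor_relations" "t - u \<in> rat_vector.span tensor_relations"
    then have "(s - t) + (t - u) \<in> rat_vector.span tensor_relations"
      by (rule rat_vector.span_add)
    then show "s - u \<in> rat_vector.span tensor_relations" by simp
  qed
qed

quotient_type (overloaded) ('a, 'b) tensor =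
    "('a :: rat_vector \<times> 'b :: rat_vector) \<Rightarrow>\<^sub>0 rat" / tensor_equiv
  by (rule equivp_tensor_equiv)

instantiation tensor :: (rat_vector, rat_vector) rat_vector
begin
lift_definition zero_tensor :: "('a, 'b) tensor" is 0 .
lift_definition plus_tensor :: "('a, 'b) tensor \<Rightarrow> ('a, 'b) tensor \<Rightarrow> ('a, 'b) tensor" is "(+)"
  unfolding tensor_equiv_def by (metis add_diff_add rat_vector.span_add)
lift_definition uminus_tensor :: "('a, 'b) tensor \<Rightarrow> ('a, 'b) tensor" is uminus
  unfolding tensor_equiv_def by (metis minus_diff_minus rat_vector.span_neg)
lift_definition minus_tensor :: "('a, 'b) tensor \<Rightarrow> ('a, 'b) tensor \<Rightarrow> ('a, 'b) tensor" is "(-)"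
  unfolding tensor_equiv_def by (drule (1) rat_vector.span_diff) (simp add: algebra_simps)
lift_definition scaleQ_tensor :: "rat \<Rightarrow> ('a, 'b) tensor \<Rightarrow> ('a, 'b) tensor" is scaleQ
  unfolding tensor_equiv_def by (metis rat_vector.scale_right_diff_distrib rat_vector.span_scale)
instance
  by standard (transfer, simp add: tensor_equiv_def algebra_simps scaleQ_add_right scaleQ_add_left
    scaleQ_scaleQ scaleQ_one rat_vector.span_zero)+
end

lift_definition tensor_pair :: "'a :: rat_vector \<Rightarrow> 'b :: rat_vector \<Rightarrow> ('a, 'b) tensor"
    (infixr "\<otimes>" 76)
  is "\<lambda>x y. Poly_Mapping.single (x, y) 1" .

lemma tensor_add_left: "(x + x') \<otimes> y = x \<otimes> y + x' \<otimes> y"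
proof (transfer, unfold tensor_equiv_def, rule rat_vector.span_base)
  show "Poly_Mapping.single (x + x', y) 1 - (Poly_Mapping.single (x, y) 1 + Poly_Mapping.single (x', y) 1)
      \<in> tensor_relations" for x x' :: 'a and y :: 'b
    unfolding diff_diff_eq[symmetric] tensor_relations_def by blast
qed

lemma tensor_add_right: "x \<otimes> (y + y') = x \<otimes> y + x \<otimes> y'"
proof (transfer, unfold tensor_equiv_def, rule rat_vector.span_base)
  show "Poly_Mapping.single (x, y + y') 1 - (Poly_Mapping.single (x, y) 1 + Poly_Mapping.single (x, y') 1)
      \<in> tensor_relations" for x :: 'a and y y' :: 'b
    unfolding diff_diff_eq[symmetric] tensor_relations_def by blast
qed

lemma tensor_scaleQ_left: "(c *\<^sub>Q x) \<otimes> y = c *\<^sub>Q (x \<otimes> y)"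
  by (transfer, unfold tensor_equiv_def, rule rat_vector.span_base, unfold tensor_relations_def, blast)

lemma tensor_scaleQ_right: "x \<otimes> (c *\<^sub>Q y) = c *\<^sub>Q (x \<otimes> y)"
  by (transfer, unfold tensor_equiv_def, rule rat_vector.span_base, unfold tensor_relations_def, blast)


section \<open>Compositions\<close>

definition composition :: "nat list \<Rightarrow> bool" where
  "composition \<alpha> \<longleftrightarrow> (\<forall>a\<in>set \<alpha>. 0 < a)"

definition is_refinement_blocks :: "nat list \<Rightarrow> nat list \<Rightarrow> nat list list \<Rightarrow> bool" where
  "is_refinement_blocks \<alpha> \<beta> bs \<longleftrightarrow>
     [] \<notin> set bs \<and> concat bs = \<alpha> \<and> map sum_list bs = \<beta>"

definition refines :: "nat list \<Rightarrow> nat list \<Rightarrow> bool" where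
  "refines \<alpha> \<beta> \<longleftrightarrow> (\<exists>bs. is_refinement_blocks \<alpha> \<beta> bs)"

definition refinement_blocks :: "nat list \<Rightarrow> nat list \<Rightarrow> nat list list" where
  "refinement_blocks \<alpha> \<beta> = (THE bs. is_refinement_blocks \<alpha> \<beta> bs)"

text \<open>The factorial \<open>c\<^sub>i(\<alpha>,\<beta>)!\<close>.\<close>

definition block_mult_fact :: "nat \<Rightarrow> nat list \<Rightarrow> nat list \<Rightarrow> nat" where
  "block_mult_fact i \<alpha> \<beta> = (\<Prod>b\<leftarrow>refinement_blocks \<alpha> \<beta>. fact (count_list b i))"

text \<open>
  The coefficient \<open>C\<^bsub>\<alpha>\<beta>\<^esub>\<close>. No part of \<open>\<alpha>\<close> exceeds \<open>sum_list \<alpha>\<close>, so all further factors of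
  the product over \<open>i \<ge> 1\<close> are 1.
\<close>

definition powersum_coeff :: "nat list \<Rightarrow> nat list \<Rightarrow> rat" where
  "powersum_coeff \<alpha> \<beta> =
     (\<Prod>i=1..sum_list \<alpha>. fact (count_list \<alpha> i) / of_nat (block_mult_fact i \<alpha> \<beta>))"

fun descending_runs :: "nat list \<Rightarrow> nat list list" where
  "descending_runs [] = []"
| "descending_runs [a] = [[a]]"
| "descending_runs (a # b # xs) =
     (let rs = descending_runs (b # xs)
      in if a < b then [a] # rs else (a # hd rs) # tl rs)"

definition sum_runs :: "nat list \<Rightarrow> nat list" where
  "sum_runs \<alpha> = map sum_list (descending_runs \<alpha>)"

lemma "sum_runs [3,2,1,1,3,1,1,1,2,1] = [7,6,3]"
  by (simp add: sum_runs_def)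

lemma is_refinement_blocks_unique:
  assumes "composition \<alpha>" "is_refinement_blocks \<alpha> \<beta> bs" "is_refinement_blocks \<alpha> \<beta> bs'"
  shows "bs = bs'"
  using assms
proof (induction bs arbitrary: \<alpha> \<beta> bs')
  case Nil
  then show ?case by (auto simp: is_refinement_blocks_def)
next
  case (Cons b bs)
  from Cons.prems obtain c cs where bs': "bs' = c # cs"
    by (cases bs') (auto simp: is_refinement_blocks_def)
  have eq: "b @ concat bs = c @ concat cs" and sums: "sum_list b = sum_list c"
    and pos: "\<forall>a\<in>set (b @ concat bs). 0 < a" "\<forall>a\<in>set (c @ concat cs). 0 < a"
    and rest: "map sum_list bs = map sum_list cs"
    using Cons.prems unfolding bs' by (auto simp: is_refinement_blocks_def composition_def)
  from eq obtain us where us: "b = c @ us \<and> us @ concat bs = concat cs \<or>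
      b @ us = c \<and> concat bs = us @ concat cs"
    by (auto simp: append_eq_append_conv2)
  have "\<forall>a\<in>set us. 0 < a" "sum_list us = 0"
    using us sums pos by auto
  then have "us = []" by (cases us) auto
  with us have *: "b = c" "concat bs = concat cs" by auto
  have "bs = cs"
    by (rule Cons.IH[of "concat bs" "map sum_list bs"])
       (use Cons.prems * rest pos in \<open>auto simp: bs' is_refinement_blocks_def composition_def\<close>)
  with * bs' show ?case by simp
qed

lemma refinement_blocks_eq:
  assumes "composition \<alpha>" "is_refinement_blocks \<alpha> \<beta> bs"
  shows "refinement_blocks \<alpha> \<beta> = bs"
  unfolding refinement_blocks_def
  by (rule the_equality) (use assms is_refinement_blocks_unique in blast)+

lemma refines_props:
  assumes "refines \<alpha> \<beta>"
  shows "sum_list \<beta> = sum_list \<alpha>" and "length \<beta> \<le> length \<alpha>"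
    and "composition \<alpha> \<Longrightarrow> composition \<beta>"
proof -
  from assms obtain bs where bs: "[] \<notin> set bs" "\<alpha> = concat bs" "\<beta> = map sum_list bs"
    by (auto simp: refines_def is_refinement_blocks_def)
  show "sum_list \<beta> = sum_list \<alpha>"
    unfolding bs(2,3) by (induction bs) auto
  show "length \<beta> \<le> length \<alpha>"
    unfolding bs(2,3) using bs(1)
  proof (induction bs)
    case (Cons b bs)
    then show ?case by (cases b) auto
  qed simp
  show "composition \<beta>" if "composition \<alpha>"
  proof -
    have "0 < sum_list b" if "b \<in> set bs" for b
      using \<open>composition \<alpha>\<close> bs that
      by (cases b) (auto simp: composition_def)
    then show ?thesis by (auto simp: composition_def bs(3))
  qed
qed

lemma finite_refines: "finite {\<beta>. refines \<alpha> \<beta>}"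
proof (rule finite_subset)
  show "{\<beta>. refines \<alpha> \<beta>} \<subseteq> {\<beta>. set \<beta> \<subseteq> {..sum_list \<alpha>} \<and> length \<beta> \<le> length \<alpha>}"
    using refines_props by (auto intro: member_le_sum_list simp flip: refines_props(1))
  show "finite {\<beta>. set \<beta> \<subseteq> {..sum_list \<alpha>} \<and> length \<beta> \<le> length \<alpha>}"
    by (rule finite_lists_length_le) simp
qed


section \<open>Quasisymmetric functions\<close>

text \<open>
  A monomial is its finitely supported exponent vector, and a formal power series is its
  coefficient function. The variables are indexed by \<open>0, 1, \<dots>\<close> instead of \<open>1, 2, \<dots>\<close>.
\<close>

type_synonym monomial = "nat \<Rightarrow>\<^sub>0 nat"

definition monom_of :: "nat list \<Rightarrow> nat list \<Rightarrow> monomial" where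
  "monom_of is \<alpha> = sum_list (map2 Poly_Mapping.single is \<alpha>)"

definition monom_degree :: "monomial \<Rightarrow> nat" where
  "monom_degree m = sum (Poly_Mapping.lookup m) (Poly_Mapping.keys m)"

definition quasisymmetric :: "(monomial \<Rightarrow> rat) \<Rightarrow> bool" where
  "quasisymmetric f \<longleftrightarrow>
     (\<forall>\<alpha> is js. composition \<alpha> \<longrightarrow>
        sorted_wrt (<) is \<longrightarrow> sorted_wrt (<) js \<longrightarrow>
        length is = length \<alpha> \<longrightarrow> length js = length \<alpha> \<longrightarrow>
        f (monom_of is \<alpha>) = f (monom_of js \<alpha>))"

definition bounded_degree :: "(monomial \<Rightarrow> rat) \<Rightarrow> bool" where
  "bounded_degree f \<longleftrightarrow> (\<exists>d. \<forall>m. f m \<noteq> 0 \<longrightarrow> monom_degree m \<le> d)"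

typedef qsym = "{f. quasisymmetric f \<and> bounded_degree f}"
  morphisms qsym_coeff Abs_qsym
  by (rule exI[of _ "\<lambda>_. 0"]) (auto simp: quasisymmetric_def bounded_degree_def)

setup_lifting type_definition_qsym

lemma quasisymmetricD:
  assumes "quasisymmetric f" "composition \<alpha>" "sorted_wrt (<) is" "sorted_wrt (<) js"
    and "length is = length \<alpha>" "length js = length \<alpha>"
  shows "f (monom_of is \<alpha>) = f (monom_of js \<alpha>)"
  using assms unfolding quasisymmetric_def by blast

lemma quasisymmetric_pointwise:
  assumes "quasisymmetric f" "quasisymmetric g"
  shows "quasisymmetric (\<lambda>m. h (f m) (g m))"
  unfolding quasisymmetric_def
proof (intro allI impI)
  fix \<alpha> "is" js :: "nat list"
  assume *: "composition \<alpha>" "sorted_wrt (<) is" "sorted_wrt (<) js"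
    "length is = length \<alpha>" "length js = length \<alpha>"
  show "h (f (monom_of is \<alpha>)) (g (monom_of is \<alpha>)) = h (f (monom_of js \<alpha>)) (g (monom_of js \<alpha>))"
    unfolding quasisymmetricD[OF assms(1) *] quasisymmetricD[OF assms(2) *] ..
qed

lemma bounded_degree_pointwise:
  assumes "bounded_degree f" "bounded_degree g" "\<And>m. f m = 0 \<Longrightarrow> g m = 0 \<Longrightarrow> h m = 0"
  shows "bounded_degree h"
proof -
  from assms obtain d e where "\<forall>m. f m \<noteq> 0 \<longrightarrow> monom_degree m \<le> d" "\<forall>m. g m \<noteq> 0 \<longrightarrow> monom_degree m \<le> e"
    by (auto simp: bounded_degree_def)
  then have "\<forall>m. h m \<noteq> 0 \<longrightarrow> monom_degree m \<le> max d e"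
    using assms(3) by (meson le_max_iff_disj)
  then show ?thesis by (auto simp: bounded_degree_def)
qed

instantiation qsym :: rat_vector
begin
lift_definition zero_qsym :: qsym is "\<lambda>_. 0"
  by (auto simp: quasisymmetric_def bounded_degree_def)
lift_definition plus_qsym :: "qsym \<Rightarrow> qsym \<Rightarrow> qsym" is "\<lambda>f g m. f m + g m"
  by (elim conjE, intro conjI quasisymmetric_pointwise[where h = "(+)"])
     (assumption | rule bounded_degree_pointwise, assumption, assumption, simp)+
lift_definition minus_qsym :: "qsym \<Rightarrow> qsym \<Rightarrow> qsym" is "\<lambda>f g m. f m - g m"
  by (elim conjE, intro conjI quasisymmetric_pointwise[where h = "(-)"])
     (assumption | rule bounded_degree_pointwise, assumption, assumption, simp)+
lift_definition uminus_qsym :: "qsym \<Rightarrow> qsym" is "\<lambda>f m. - f m"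
  by (elim conjE, intro conjI quasisymmetric_pointwise[where h = "\<lambda>x _. - x"])
     (assumption | rule bounded_degree_pointwise, assumption, assumption, simp)+
lift_definition scaleQ_qsym :: "rat \<Rightarrow> qsym \<Rightarrow> qsym" is "\<lambda>c f m. c * f m"
  by (elim conjE, rule conjI, rule quasisymmetric_pointwise[where h = "\<lambda>x _. _ * x"])
     (assumption | rule bounded_degree_pointwise, assumption, assumption, simp)+
instance
  by standard (simp_all add: qsym_coeff_inject[symmetric] fun_eq_iff zero_qsym.rep_eq
    plus_qsym.rep_eq minus_qsym.rep_eq uminus_qsym.rep_eq scaleQ_qsym.rep_eq algebra_simps)
end

text \<open>
  The coefficient of \<open>m\<close> in \<open>\<Sum>\<^bsub>i\<^sub>1<\<dots><i\<^sub>k\<^esub> x\<^bsub>i\<^sub>1\<^esub>\<^bsup>a\<^sub>1\<^esup> \<dots> x\<^bsub>i\<^sub>k\<^esub>\<^bsup>a\<^sub>k\<^esup>\<close> is the number of index sequences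
  that produce \<open>m\<close>.
\<close>

definition monomial_series :: "nat list \<Rightarrow> monomial \<Rightarrow> rat" where
  "monomial_series \<alpha> m =
     of_nat (card {is. sorted_wrt (<) is \<and> length is = length \<alpha> \<and> monom_of is \<alpha> = m})"

text \<open>Only meaningful for compositions, see \<open>qsym_coeff_M\<close> below.\<close>

definition M :: "nat list \<Rightarrow> qsym" where
  "M \<alpha> = Abs_qsym (monomial_series \<alpha>)"

lemma lookup_monom_of:
  assumes "length is = length \<alpha>" "distinct is"
  shows "Poly_Mapping.lookup (monom_of is \<alpha>) i = (case map_of (zip is \<alpha>) i of None \<Rightarrow> 0 | Some a \<Rightarrow> a)"
  using assms
proof (induction "is" \<alpha> rule: list_induct2)
  case Nil
  then show ?case by (simp add: monom_of_def)
next
  case (Cons j js a \<alpha>)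
  then have "map_of (zip js \<alpha>) j = None" by (simp add: map_of_zip_is_None)
  with Cons show ?case
    by (auto simp: monom_of_def lookup_add lookup_single when_def simp del: map_of_zip_is_None)
qed

lemma keys_monom_of:
  assumes "length is = length \<alpha>" "distinct is" "composition \<alpha>"
  shows "Poly_Mapping.keys (monom_of is \<alpha>) = set is"
proof -
  have "i \<in> Poly_Mapping.keys (monom_of is \<alpha>) \<longleftrightarrow> i \<in> set is" for i
  proof (cases "i \<in> set is")
    case True
    then obtain a where a: "map_of (zip is \<alpha>) i = Some a"
      using assms(1) by (metis map_of_zip_is_Some)
    then have "0 < a"
      using assms(3) by (auto dest!: map_of_SomeD set_zip_rightD simp: composition_def)
    with a True show ?thesis
      by (simp add: in_keys_iff lookup_monom_of assms)
  next
    case False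
    then have "map_of (zip is \<alpha>) i = None" using assms(1) by (simp add: map_of_zip_is_None)
    with False show ?thesis
      by (simp add: in_keys_iff lookup_monom_of assms del: map_of_zip_is_None)
  qed
  then show ?thesis by blast
qed

lemma map_lookup_monom_of:
  assumes "length is = length \<alpha>" "distinct is"
  shows "map (Poly_Mapping.lookup (monom_of is \<alpha>)) is = \<alpha>"
  by (rule nth_equalityI) (use assms in \<open>auto simp: lookup_monom_of map_of_zip_nth\<close>)

lemma monom_of_inject:
  assumes "composition \<alpha>" "composition \<beta>" "sorted_wrt (<) is" "sorted_wrt (<) js"
    and "length is = length \<alpha>" "length js = length \<beta>"
  shows "monom_of is \<alpha> = monom_of js \<beta> \<longleftrightarrow> is = js \<and> \<alpha> = \<beta>"
proof
  have d: "distinct is" "distinct js"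
    using assms strict_sorted_iff by auto
  assume eq: "monom_of is \<alpha> = monom_of js \<beta>"
  then have "set is = set js"
    using keys_monom_of assms d by metis
  then have "is = js"
    using assms by (simp add: strict_sorted_equal)
  moreover from this eq have "\<alpha> = \<beta>"
    using map_lookup_monom_of assms d by metis
  ultimately show "is = js \<and> \<alpha> = \<beta>" by simp
qed simp

lemma monomial_series_monom_of:
  assumes "composition \<alpha>" "composition \<beta>" "sorted_wrt (<) js" "length js = length \<beta>"
  shows "monomial_series \<alpha> (monom_of js \<beta>) = of_bool (\<alpha> = \<beta>)"
proof -
  have "{is. sorted_wrt (<) is \<and> length is = length \<alpha> \<and> monom_of is \<alpha> = monom_of js \<beta>} =
      (if \<alpha> = \<beta> then {js} else {})"
    using assms by (auto simp: monom_of_inject)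
  then show ?thesis by (simp add: monomial_series_def)
qed

lemma monom_degree_monom_of:
  assumes "length is = length \<alpha>" "distinct is" "composition \<alpha>"
  shows "monom_degree (monom_of is \<alpha>) = sum_list \<alpha>"
proof -
  have "monom_degree (monom_of is \<alpha>) = sum (Poly_Mapping.lookup (monom_of is \<alpha>)) (set is)"
    by (simp only: monom_degree_def keys_monom_of[OF assms])
  also have "\<dots> = sum_list (map (Poly_Mapping.lookup (monom_of is \<alpha>)) is)"
    by (rule sum_list_distinct_conv_sum_set[symmetric]) (rule assms)
  finally show ?thesis by (simp only: map_lookup_monom_of[OF assms(1,2)])
qed

lemma qsym_coeff_M:
  assumes "composition \<alpha>"
  shows "qsym_coeff (M \<alpha>) = monomial_series \<alpha>"
proof -
  have "quasisymmetric (monomial_series \<alpha>)"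
    unfolding quasisymmetric_def using assms by (auto simp: monomial_series_monom_of)
  moreover have "monom_degree m \<le> sum_list \<alpha>" if "monomial_series \<alpha> m \<noteq> 0" for m
  proof -
    have "{is. sorted_wrt (<) is \<and> length is = length \<alpha> \<and> monom_of is \<alpha> = m} \<noteq> {}"
      using that unfolding monomial_series_def by (metis card.empty of_nat_0)
    then obtain "is" where "is": "sorted_wrt (<) is" "length is = length \<alpha>" "m = monom_of is \<alpha>"
      by blast
    then have "distinct is" by (simp add: strict_sorted_iff)
    with "is" show ?thesis
      by (simp add: monom_degree_monom_of assms)
  qed
  ultimately show ?thesis
    unfolding M_def by (subst Abs_qsym_inverse) (auto simp: bounded_degree_def)
qed

definition powersum :: "nat list \<Rightarrow> qsym" where
  "powersum \<alpha> =
     (\<Sum>\<beta> | refines \<alpha> \<beta> \<and> refines \<beta> (sum_runs \<alpha>). powersum_coeff \<alpha> \<beta> *\<^sub>Q M \<beta>)"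

lemma powersum_Nil: "powersum [] = M []"
proof -
  have "is_refinement_blocks [] \<beta> bs \<longleftrightarrow> bs = [] \<and> \<beta> = []" for \<beta> bs
    by (cases bs) (auto simp: is_refinement_blocks_def)
  then have "{\<beta>. refines [] \<beta> \<and> refines \<beta> (sum_runs [])} = {[]}"
    by (auto simp: refines_def sum_runs_def)
  then show ?thesis
    by (simp add: powersum_def powersum_coeff_def scaleQ_one)
qed


section \<open>The coproduct\<close>

text \<open>The coefficient of \<open>M \<gamma>\<close> in \<open>f\<close>.\<close>

definition M_coeff :: "qsym \<Rightarrow> nat list \<Rightarrow> rat" where
  "M_coeff f \<gamma> = qsym_coeff f (monom_of [0..<length \<gamma>] \<gamma>)"

text \<open>
  The linear map determined by its values on the basis elements \<open>M \<gamma>\<close>; the lemmas below show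
  that these form a basis, that the map is linear, and that it has the prescribed values.
\<close>

definition coproduct :: "qsym \<Rightarrow> (qsym, qsym) tensor" where
  "coproduct f =
     (\<Sum>\<gamma> | composition \<gamma> \<and> M_coeff f \<gamma> \<noteq> 0.
        M_coeff f \<gamma> *\<^sub>Q (\<Sum>(\<alpha>, \<beta>) | \<alpha> @ \<beta> = \<gamma>. M \<alpha> \<otimes> M \<beta>))"

lemma M_coeff_add: "M_coeff (f + g) \<gamma> = M_coeff f \<gamma> + M_coeff g \<gamma>"
  by (simp add: M_coeff_def plus_qsym.rep_eq)

lemma M_coeff_scaleQ: "M_coeff (c *\<^sub>Q f) \<gamma> = c * M_coeff f \<gamma>"
  by (simp add: M_coeff_def scaleQ_qsym.rep_eq)

lemma M_coeff_M:
  assumes "composition \<alpha>" "composition \<gamma>"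
  shows "M_coeff (M \<alpha>) \<gamma> = of_bool (\<alpha> = \<gamma>)"
  using assms by (simp add: M_coeff_def qsym_coeff_M monomial_series_monom_of)

lemma length_le_sum_list: "composition \<alpha> \<Longrightarrow> length \<alpha> \<le> sum_list \<alpha>"
  by (induction \<alpha>) (auto simp: composition_def)

lemma finite_compositions_le: "finite {\<gamma>. composition \<gamma> \<and> sum_list \<gamma> \<le> d}"
proof (rule finite_subset)
  show "{\<gamma>. composition \<gamma> \<and> sum_list \<gamma> \<le> d} \<subseteq> {\<gamma>. set \<gamma> \<subseteq> {..d} \<and> length \<gamma> \<le> d}"
    by (auto intro: order_trans[OF length_le_sum_list] order_trans[OF member_le_sum_list])
  show "finite {\<gamma>. set \<gamma> \<subseteq> {..d} \<and> length \<gamma> \<le> d}"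
    by (rule finite_lists_length_le) simp
qed

lemma finite_M_coeff: "finite {\<gamma>. composition \<gamma> \<and> M_coeff f \<gamma> \<noteq> 0}"
proof -
  obtain d where d: "\<And>m. qsym_coeff f m \<noteq> 0 \<Longrightarrow> monom_degree m \<le> d"
    using qsym_coeff[of f] by (auto simp: bounded_degree_def)
  have "{\<gamma>. composition \<gamma> \<and> M_coeff f \<gamma> \<noteq> 0} \<subseteq> {\<gamma>. composition \<gamma> \<and> sum_list \<gamma> \<le> d}"
    using d by (auto simp: M_coeff_def) (metis distinct_upt length_upt diff_zero monom_degree_monom_of)
  then show ?thesis by (rule finite_subset) (rule finite_compositions_le)
qed

lemma coproduct_superset:
  assumes "finite S" "\<And>\<gamma>. composition \<gamma> \<Longrightarrow> M_coeff f \<gamma> \<noteq> 0 \<Longrightarrow> \<gamma> \<in> S" "\<forall>\<gamma>\<in>S. composition \<gamma>"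
  shows "coproduct f = (\<Sum>\<gamma>\<in>S. M_coeff f \<gamma> *\<^sub>Q (\<Sum>(\<alpha>, \<beta>) | \<alpha> @ \<beta> = \<gamma>. M \<alpha> \<otimes> M \<beta>))"
  unfolding coproduct_def
  by (rule sum.mono_neutral_left) (use assms in auto)

lemma coproduct_add: "coproduct (f + g) = coproduct f + coproduct g"
proof -
  let ?S = "{\<gamma>. composition \<gamma> \<and> M_coeff f \<gamma> \<noteq> 0} \<union> {\<gamma>. composition \<gamma> \<and> M_coeff g \<gamma> \<noteq> 0}"
  have fin: "finite ?S" by (simp add: finite_M_coeff)
  have *: "coproduct h = (\<Sum>\<gamma>\<in>?S. M_coeff h \<gamma> *\<^sub>Q (\<Sum>(\<alpha>, \<beta>) | \<alpha> @ \<beta> = \<gamma>. M \<alpha> \<otimes> M \<beta>))"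
    if "\<And>\<gamma>. composition \<gamma> \<Longrightarrow> M_coeff h \<gamma> \<noteq> 0 \<Longrightarrow> \<gamma> \<in> ?S" for h
    by (rule coproduct_superset[OF fin that]) auto
  have "coproduct (f + g) = (\<Sum>\<gamma>\<in>?S. M_coeff (f + g) \<gamma> *\<^sub>Q (\<Sum>(\<alpha>, \<beta>) | \<alpha> @ \<beta> = \<gamma>. M \<alpha> \<otimes> M \<beta>))"
    by (rule *) (auto simp: M_coeff_add)
  also have "\<dots> = coproduct f + coproduct g"
    unfolding M_coeff_add scaleQ_add_left sum.distrib by (subst (1 2) *) auto
  finally show ?thesis .
qed

lemma coproduct_scaleQ: "coproduct (c *\<^sub>Q f) = c *\<^sub>Q coproduct f"
proof -
  have "coproduct (c *\<^sub>Q f) = (\<Sum>\<gamma> | composition \<gamma> \<and> M_coeff f \<gamma> \<noteq> 0.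
      M_coeff (c *\<^sub>Q f) \<gamma> *\<^sub>Q (\<Sum>(\<alpha>, \<beta>) | \<alpha> @ \<beta> = \<gamma>. M \<alpha> \<otimes> M \<beta>))"
    by (rule coproduct_superset[OF finite_M_coeff]) (auto simp: M_coeff_scaleQ)
  then show ?thesis
    by (simp only: coproduct_def M_coeff_scaleQ rat_vector.scale_sum_right scaleQ_scaleQ)
qed

lemma coproduct_M:
  assumes "composition \<gamma>"
  shows "coproduct (M \<gamma>) = (\<Sum>(\<alpha>, \<beta>) | \<alpha> @ \<beta> = \<gamma>. M \<alpha> \<otimes> M \<beta>)"
  by (subst coproduct_superset[of "{\<gamma>}"])
     (use assms in \<open>auto simp: M_coeff_M scaleQ_one split: if_splits\<close>)

lemma M_expansion: "f = (\<Sum>\<gamma> | composition \<gamma> \<and> M_coeff f \<gamma> \<noteq> 0. M_coeff f \<gamma> *\<^sub>Q M \<gamma>)"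
proof -
  let ?S = "{\<gamma>. composition \<gamma> \<and> M_coeff f \<gamma> \<noteq> 0}"
  have coeff_sum: "qsym_coeff (\<Sum>x\<in>A. h x) m = (\<Sum>x\<in>A. qsym_coeff (h x) m)" for A and h :: "nat list \<Rightarrow> qsym" and m
    by (induction A rule: infinite_finite_induct) (auto simp: zero_qsym.rep_eq plus_qsym.rep_eq)
  have "qsym_coeff f m = qsym_coeff (\<Sum>\<gamma>\<in>?S. M_coeff f \<gamma> *\<^sub>Q M \<gamma>) m" for m
  proof -
    define js where "js = sorted_list_of_set (Poly_Mapping.keys m)"
    define \<beta> where "\<beta> = map (Poly_Mapping.lookup m) js"
    have js: "sorted_wrt (<) js" "length js = length \<beta>" "distinct js" "set js = Poly_Mapping.keys m"
      by (auto simp: js_def \<beta>_def)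
    have \<beta>: "composition \<beta>"
      by (auto simp: composition_def \<beta>_def js(4) in_keys_iff)
    have m: "m = monom_of js \<beta>"
    proof (rule poly_mapping_eqI)
      fix k
      show "Poly_Mapping.lookup m k = Poly_Mapping.lookup (monom_of js \<beta>) k"
        using lookup_monom_of[OF js(2,3), of k] js(4)
        by (auto simp: \<beta>_def map_of_zip_map in_keys_iff)
    qed
    have "qsym_coeff f m = M_coeff f \<beta>"
      unfolding M_coeff_def m using qsym_coeff[of f] js \<beta> by (intro quasisymmetricD) auto
    also have "\<dots> = (\<Sum>\<gamma>\<in>?S. M_coeff f \<gamma> * of_bool (\<gamma> = \<beta>))"
      using \<beta> by (auto simp: of_bool_def if_distrib sum.delta finite_M_coeff cong: if_cong)
    also have "\<dots> = (\<Sum>\<gamma>\<in>?S. M_coeff f \<gamma> * qsym_coeff (M \<gamma>) m)"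
      by (rule sum.cong) (auto simp: m qsym_coeff_M monomial_series_monom_of js \<beta>)
    finally show ?thesis by (simp add: coeff_sum scaleQ_qsym.rep_eq)
  qed
  then show ?thesis by (simp add: qsym_coeff_inject[symmetric] fun_eq_iff)
qed

end

theory Submission
  imports Defs
begin

text \<open>
  The compositions \<open>\<beta>\<close> with \<open>\<gamma> \<le> \<beta> \<le> C(\<gamma>)\<close> are exactly the block sums of the factorizations
  \<open>bs\<close> of \<open>\<gamma>\<close> into nonempty weakly decreasing blocks, so that \<open>P\<^sub>\<gamma>\<close> is a sum over such
  factorizations. Deconcatenating the block sums amounts to cutting \<open>bs\<close> into \<open>bs\<^sub>1 @ bs\<^sub>2\<close>, that
  is, to cutting \<open>\<gamma>\<close> into \<open>\<alpha> @ \<beta>\<close> and choosing factorizations of \<open>\<alpha>\<close> and \<open>\<beta>\<close> independently. The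
  denominators of the coefficients are multiplicative in \<open>bs\<close>, which leaves the factor
  \<open>\<Prod>\<^sub>i m\<^sub>i(\<gamma>)! / (m\<^sub>i(\<alpha>)! m\<^sub>i(\<beta>)!)\<close>.
\<close>

section \<open>Weakly decreasing factorizations and descending runs\<close>

definition descending_factorizations :: "nat list \<Rightarrow> nat list list set" where
  "descending_factorizations \<gamma> =
     {bs. [] \<notin> set bs \<and> concat bs = \<gamma> \<and> (\<forall>b\<in>set bs. sorted_wrt (\<ge>) b)}"

text \<open>The third fact carries the fourth through the induction: prepending \<open>a\<close> to
  the first run keeps that run weakly decreasing because it starts with \<open>b\<close>.\<close>

lemma descending_runs_props:
  "concat (descending_runs \<gamma>) = \<gamma>"
  "[] \<notin> set (descending_runs \<gamma>)"
  "\<gamma> \<noteq> [] \<Longrightarrow> descending_runs \<gamma> \<noteq> [] \<and> hd (hd (descending_runs \<gamma>)) = hd \<gamma>"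
  "\<forall>b\<in>set (descending_runs \<gamma>). sorted_wrt (\<ge>) b"
proof (induction \<gamma> rule: descending_runs.induct)
  case (3 a b xs)
  obtain r rs where r: "descending_runs (b # xs) = r # rs"
    using 3(3) by (cases "descending_runs (b # xs)") auto
  obtain r' where r': "r = b # r'"
    using 3(2,3) r by (cases r) auto
  {
    case 1 show ?case using 3(1) by (auto simp: r Let_def)
  next
    case 2 show ?case using 3(2) by (auto simp: r Let_def)
  next
    case 3 show ?case by (auto simp: r Let_def)
  next
    case 4 show ?case using 3(4) by (auto simp: r r' Let_def)
  }
qed auto

text \<open>No break occurs inside a weakly decreasing \<open>b\<close>, so only the junction with
  \<open>xs\<close> decides whether \<open>b\<close> is a run of its own or extends the first run of
  \<open>xs\<close>.\<close>

lemma descending_runs_append: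
  assumes "b \<noteq> []" "sorted_wrt (\<ge>) b"
  shows "descending_runs (b @ xs) =
    (if xs = [] \<or> last b < hd xs then b # descending_runs xs
     else (b @ hd (descending_runs xs)) # tl (descending_runs xs))"
  using assms
proof (induction b)
  case (Cons a b)
  show ?case
  proof (cases b)
    case Nil
    then show ?thesis by (cases xs) (auto simp: Let_def)
  next
    case (Cons a' b')
    with Cons.IH Cons.prems show ?thesis by (auto simp: Let_def)
  qed
qed simp

text \<open>A weakly decreasing block never straddles a strict ascent, so the breaks defining the
  runs all lie between blocks. Going from right to left, each block either opens a new group or
  joins the first one.\<close>

lemma descending_runs_group:
  assumes "[] \<notin> set bs" "\<forall>b\<in>set bs. sorted_wrt (\<ge>) b"
  shows "\<exists>css. [] \<notin> set css \<and> concat css = bs \<and> map concat css = descending_runs (concat bs)"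
  using assms
proof (induction bs)
  case Nil
  show ?case by (rule exI[of _ "[]"]) simp
next
  case (Cons b bs)
  then obtain css where css: "[] \<notin> set css" "concat css = bs"
      "map concat css = descending_runs (concat bs)"
    by auto
  have runs: "descending_runs (concat (b # bs)) =
      (if concat bs = [] \<or> last b < hd (concat bs) then b # descending_runs (concat bs)
       else (b @ hd (descending_runs (concat bs))) # tl (descending_runs (concat bs)))"
    using descending_runs_append[of b "concat bs"] Cons.prems by auto
  show ?case
  proof (cases "concat bs = [] \<or> last b < hd (concat bs)")
    case True
    then show ?thesis
      using css runs by (intro exI[of _ "[b] # css"]) auto
  next
    case False
    then have "descending_runs (concat bs) \<noteq> []"
      using descending_runs_props(3) by blast
    then obtain c cs where c: "css = c # cs"
      using css(3) by (cases css) auto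
    show ?thesis
      using False css runs by (intro exI[of _ "(b # c) # cs"]) (auto simp: c simp flip: css(3))
  qed
qed

section \<open>The interval between \<gamma> and C(\<gamma>)\<close>

text \<open>Lengths alone locate the cuts, so a grouping of the images lifts to the original list.
  This turns a grouping of block sums into a grouping of the blocks themselves.\<close>

lemma concat_eq_map_conv:
  "concat ds = map f bs \<Longrightarrow> \<exists>css. concat css = bs \<and> map (map f) css = ds"
proof (induction ds arbitrary: bs)
  case Nil
  then show ?case by (intro exI[of _ "[]"]) simp
next
  case (Cons d ds)
  then obtain us vs where uv: "bs = us @ vs" "d = map f us" "concat ds = map f vs"
    by (auto simp: append_eq_map_conv)
  with Cons.IH obtain css where "concat css = vs" "map (map f) css = ds" by blast
  with uv show ?case by (intro exI[of _ "us # css"]) simp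
qed

lemma sorted_wrt_concat_block:
  "sorted_wrt P (concat bs) \<Longrightarrow> b \<in> set bs \<Longrightarrow> sorted_wrt P b"
  by (induction bs) (auto simp: sorted_wrt_append)

lemma sum_list_concat_map: "sum_list (map sum_list xss) = sum_list (concat xss)"
  by (induction xss) auto

lemma concat_concat_map: "concat (map concat xsss) = concat (concat xsss)"
  by (induction xsss) auto

text \<open>Injectivity is the uniqueness of refinement blocks. For the image, coarsening weakly
  decreasing blocks leads to the runs, and conversely the blocks of any \<beta> in the interval lie
  inside runs.\<close>

lemma powersum_index_bij:
  assumes "composition \<gamma>"
  shows "bij_betw (map sum_list) (descending_factorizations \<gamma>)
    {\<beta>. refines \<gamma> \<beta> \<and> refines \<beta> (sum_runs \<gamma>)}"
proof (rule bij_betw_imageI)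
  show "inj_on (map sum_list) (descending_factorizations \<gamma>)"
  proof (rule inj_onI)
    fix bs cs
    assume "bs \<in> descending_factorizations \<gamma>" "cs \<in> descending_factorizations \<gamma>"
      "map sum_list bs = map sum_list cs"
    then show "bs = cs"
      by (intro is_refinement_blocks_unique[OF assms, of "map sum_list bs"])
         (auto simp: descending_factorizations_def is_refinement_blocks_def)
  qed
  show "map sum_list ` descending_factorizations \<gamma> =
      {\<beta>. refines \<gamma> \<beta> \<and> refines \<beta> (sum_runs \<gamma>)}"
  proof (intro equalityI subsetI)
    fix \<beta> assume "\<beta> \<in> map sum_list ` descending_factorizations \<gamma>"
    then obtain bs where bs: "[] \<notin> set bs" "concat bs = \<gamma>" "\<forall>b\<in>set bs. sorted_wrt (\<ge>) b"
        and \<beta>: "\<beta> = map sum_list bs"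
      by (auto simp: descending_factorizations_def)
    from descending_runs_group[OF bs(1,3)] bs(2) obtain css where css: "[] \<notin> set css"
        "concat css = bs" "map concat css = descending_runs \<gamma>"
      by auto
    have "is_refinement_blocks \<beta> (sum_runs \<gamma>) (map (map sum_list) css)"
      using css(1,2)
      by (auto simp: is_refinement_blocks_def \<beta> sum_runs_def sum_list_concat_map map_concat
          simp flip: css(3))
    moreover have "is_refinement_blocks \<gamma> \<beta> bs"
      using bs \<beta> by (simp add: is_refinement_blocks_def)
    ultimately show "\<beta> \<in> {\<beta>. refines \<gamma> \<beta> \<and> refines \<beta> (sum_runs \<gamma>)}"
      by (auto simp: refines_def)
  next
    fix \<beta> assume "\<beta> \<in> {\<beta>. refines \<gamma> \<beta> \<and> refines \<beta> (sum_runs \<gamma>)}"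
    then obtain bs ds where bs: "[] \<notin> set bs" "concat bs = \<gamma>" "map sum_list bs = \<beta>"
        and ds: "[] \<notin> set ds" "concat ds = \<beta>" "map sum_list ds = sum_runs \<gamma>"
      by (auto simp: refines_def is_refinement_blocks_def)
    obtain css where css: "concat css = bs" "map (map sum_list) css = ds"
      using concat_eq_map_conv[of ds sum_list bs] bs ds by auto
    have nonempty: "concat cs \<noteq> []" if "cs \<in> set css" for cs
    proof -
      have "cs \<noteq> []" using that ds(1) css(2) by force
      moreover have "set cs \<subseteq> set bs" using that css(1) by auto
      ultimately show ?thesis using bs(1) by (cases cs) auto
    qed
    \<comment> \<open>Composing the two refinements divides \<gamma> into blocks with the sums of
      its runs; by uniqueness these blocks are the runs.\<close>
    have "is_refinement_blocks \<gamma> (sum_runs \<gamma>) (map concat css)"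
      unfolding is_refinement_blocks_def
    proof (intro conjI)
      show "[] \<notin> set (map concat css)" using nonempty by (metis in_set_conv_nth length_map nth_map nth_mem)
      show "concat (map concat css) = \<gamma>" using css(1) bs(2) concat_concat_map by metis
      show "map sum_list (map concat css) = sum_runs \<gamma>"
        using ds(3) by (simp add: comp_def sum_list_concat_map flip: css(2))
    qed
    moreover have "is_refinement_blocks \<gamma> (sum_runs \<gamma>) (descending_runs \<gamma>)"
      by (simp add: is_refinement_blocks_def descending_runs_props sum_runs_def)
    ultimately have runs: "map concat css = descending_runs \<gamma>"
      by (rule is_refinement_blocks_unique[OF assms])
    have "sorted_wrt (\<ge>) b" if b: "b \<in> set bs" for b
    proof -
      from b css(1) obtain cs where cs: "cs \<in> set css" "b \<in> set cs" by auto
      then have "concat cs \<in> set (descending_runs \<gamma>)" by (auto simp flip: runs)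
      then have "sorted_wrt (\<ge>) (concat cs)" using descending_runs_props(4) by blast
      then show ?thesis using cs(2) by (rule sorted_wrt_concat_block)
    qed
    then show "\<beta> \<in> map sum_list ` descending_factorizations \<gamma>"
      using bs by (auto simp: descending_factorizations_def)
  qed
qed

lemma finite_descending_factorizations:
  assumes "composition \<gamma>"
  shows "finite (descending_factorizations \<gamma>)"
proof -
  have "finite {\<beta>. refines \<gamma> \<beta> \<and> refines \<beta> (sum_runs \<gamma>)}"
    by (rule finite_subset[OF _ finite_refines[of \<gamma>]]) auto
  then show ?thesis using bij_betw_finite[OF powersum_index_bij[OF assms]] by simp
qed

section \<open>Coefficients of the powersums\<close>

text \<open>This is \<open>powersum_coeff\<close> read off from the blocks. The bound
  \<open>n\<close> is free so that \<gamma> and both of its pieces can use the same range of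
  \<open>i\<close>.\<close>

definition factorization_coeff :: "nat \<Rightarrow> nat list list \<Rightarrow> rat" where
  "factorization_coeff n bs =
     (\<Prod>i=1..n. fact (count_list (concat bs) i) / (\<Prod>b\<leftarrow>bs. fact (count_list b i)))"

text \<open>An index above the total sum is not a part, so its factor is 0!/1 = 1.\<close>

lemma factorization_coeff_cong:
  assumes "sum_list (concat bs) \<le> n"
  shows "factorization_coeff n bs = factorization_coeff (sum_list (concat bs)) bs"
  unfolding factorization_coeff_def
proof (rule prod.mono_neutral_right)
  show "\<forall>i\<in>{1..n} - {1..sum_list (concat bs)}.
      fact (count_list (concat bs) i) / (\<Prod>b\<leftarrow>bs. fact (count_list b i)) = (1 :: rat)"
  proof
    fix i assume "i \<in> {1..n} - {1..sum_list (concat bs)}"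
    then have i: "i \<notin> set (concat bs)"
      using member_le_sum_list[of i "concat bs"] by auto
    then have "count_list b i = 0" if "b \<in> set bs" for b
      using that by (auto simp: count_list_0_iff)
    then have "map (\<lambda>b. fact (count_list b i) :: rat) bs = map (\<lambda>_. 1) bs" by simp
    moreover have "count_list (concat bs) i = 0" using i by (simp add: count_list_0_iff)
    ultimately show "fact (count_list (concat bs) i) / (\<Prod>b\<leftarrow>bs. fact (count_list b i)) = (1 :: rat)"
      by (simp only:) (simp add: map_replicate_const)
  qed
qed (use assms in auto)

lemma powersum_coeff_blocks:
  assumes "composition \<gamma>" "bs \<in> descending_factorizations \<gamma>" "sum_list \<gamma> \<le> n"
  shows "powersum_coeff \<gamma> (map sum_list bs) = factorization_coeff n bs"
proof -
  have "concat bs = \<gamma>" and "is_refinement_blocks \<gamma> (map sum_list bs) bs"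
    using assms(2) by (auto simp: descending_factorizations_def is_refinement_blocks_def)
  moreover from this have "refinement_blocks \<gamma> (map sum_list bs) = bs"
    using refinement_blocks_eq assms(1) by blast
  moreover have "of_nat (prod_list (map (\<lambda>b. fact (count_list b i)) bs)) =
      (prod_list (map (\<lambda>b. fact (count_list b i)) bs) :: rat)" for i
    by (induction bs) auto
  ultimately show ?thesis
    using factorization_coeff_cong[of bs n] assms(3)
    by (simp add: powersum_coeff_def block_mult_fact_def factorization_coeff_def)
qed

lemma powersum_factorizations:
  assumes "composition \<gamma>" "sum_list \<gamma> \<le> n"
  shows "powersum \<gamma> =
    (\<Sum>bs\<in>descending_factorizations \<gamma>. factorization_coeff n bs *\<^sub>Q M (map sum_list bs))"
  unfolding powersum_def
  by (subst sum.reindex_bij_betw[OF powersum_index_bij[OF assms(1)], symmetric])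
     (use assms in \<open>simp add: powersum_coeff_blocks\<close>)

text \<open>The products of block factorials multiply under concatenation; the numerators do not,
  and the first product corrects for that.\<close>

lemma factorization_coeff_append:
  "factorization_coeff n (bs @ cs) =
    (\<Prod>i=1..n. fact (count_list (concat bs @ concat cs) i) /
      (fact (count_list (concat bs) i) * fact (count_list (concat cs) i))) *
    (factorization_coeff n bs * factorization_coeff n cs)"
  unfolding factorization_coeff_def prod.distrib[symmetric]
  by (rule prod.cong) (auto simp: field_simps)

section \<open>Finite sums under the tensor product and the coproduct\<close>

lemma tensor_zero_left: "0 \<otimes> y = 0"
  using tensor_scaleQ_left[of 0 0 y] by simp

lemma tensor_zero_right: "x \<otimes> 0 = 0"
  using tensor_scaleQ_right[of x 0 0] by simp

lemma tensor_sum_left: "(\<Sum>i\<in>A. f i) \<otimes> y = (\<Sum>i\<in>A. f i \<otimes> y)"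
  by (induction A rule: infinite_finite_induct) (simp_all add: tensor_zero_left tensor_add_left)

lemma tensor_sum_right: "x \<otimes> (\<Sum>i\<in>A. f i) = (\<Sum>i\<in>A. x \<otimes> f i)"
  by (induction A rule: infinite_finite_induct) (simp_all add: tensor_zero_right tensor_add_right)

lemma coproduct_zero: "coproduct 0 = 0"
  using coproduct_scaleQ[of 0 0] by simp

lemma coproduct_sum: "coproduct (\<Sum>i\<in>A. f i) = (\<Sum>i\<in>A. coproduct (f i))"
  by (induction A rule: infinite_finite_induct) (simp_all add: coproduct_zero coproduct_add)

section \<open>Sums over the cuts of a list\<close>

lemma finite_splits: "finite {(xs, ys). xs @ ys = zs}"
proof (rule finite_subset)
  show "{(xs, ys). xs @ ys = zs} \<subseteq> (\<lambda>k. (take k zs, drop k zs)) ` {..length zs}"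
  proof
    fix p assume "p \<in> {(xs, ys). xs @ ys = zs}"
    then show "p \<in> (\<lambda>k. (take k zs, drop k zs)) ` {..length zs}"
      by (intro image_eqI[of _ _ "length (fst p)"]) auto
  qed
qed simp

text \<open>A cut is determined by the length of its left piece, so the cuts of \<open>bs\<close>
  and of \<open>map f bs\<close> correspond even when \<open>f\<close> is not injective.\<close>

lemma sum_splits_map:
  "(\<Sum>(\<alpha>, \<beta>) | \<alpha> @ \<beta> = map f bs. g \<alpha> \<beta>) = (\<Sum>(cs, ds) | cs @ ds = bs. g (map f cs) (map f ds))"
proof -
  have "inj_on (map_prod (map f) (map f)) {(cs, ds). cs @ ds = bs}"
    by (auto simp: inj_on_def append_eq_append_conv dest: map_eq_imp_length_eq)
  moreover have "map_prod (map f) (map f) ` {(cs, ds). cs @ ds = bs} = {(\<alpha>, \<beta>). \<alpha> @ \<beta> = map f bs}"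
    by (force simp: append_eq_map_conv image_iff)
  ultimately show ?thesis
    by (subst sum.reindex_cong[of "map_prod (map f) (map f)" "{(cs, ds). cs @ ds = bs}"])
       (auto simp: case_prod_beta)
qed

text \<open>Both sides run over the pairs of factorizations whose concatenation is a factorization
  of \<gamma>; the conditions on blocks concern each block separately and so survive cutting and
  joining.\<close>

lemma sum_factorizations_split:
  assumes "composition \<gamma>"
  shows "(\<Sum>bs\<in>descending_factorizations \<gamma>. \<Sum>(cs, ds) | cs @ ds = bs. g cs ds) =
    (\<Sum>(\<alpha>, \<beta>) | \<alpha> @ \<beta> = \<gamma>.
      \<Sum>cs\<in>descending_factorizations \<alpha>. \<Sum>ds\<in>descending_factorizations \<beta>. g cs ds)"
proof -
  have comp: "composition \<alpha>" "composition \<beta>" if "\<alpha> @ \<beta> = \<gamma>" for \<alpha> \<beta>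
    using that assms by (auto simp: composition_def)
  let ?F = descending_factorizations
  have "(\<Sum>bs\<in>?F \<gamma>. \<Sum>(cs, ds) | cs @ ds = bs. g cs ds) =
      (\<Sum>(bs, p)\<in>Sigma (?F \<gamma>) (\<lambda>bs. {(cs, ds). cs @ ds = bs}). case_prod g p)"
    by (rule sum.Sigma) (auto simp: finite_descending_factorizations assms finite_splits)
  \<comment> \<open>The pair \<open>p\<close> stays fixed and determines the other component: its
    join \<open>bs\<close> on the left, the pair \<open>q\<close> of flattened pieces on the
    right.\<close>
  also have "\<dots> = (\<Sum>(q, p)\<in>Sigma {q. fst q @ snd q = \<gamma>} (\<lambda>q. ?F (fst q) \<times> ?F (snd q)). case_prod g p)"
    by (rule sum.reindex_bij_witness[where j = "\<lambda>(bs, p). (map_prod concat concat p, p)"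
          and i = "\<lambda>(q, p). (fst p @ snd p, p)"])
       (auto simp: descending_factorizations_def)
  also have "\<dots> = (\<Sum>q | fst q @ snd q = \<gamma>. \<Sum>p\<in>?F (fst q) \<times> ?F (snd q). case_prod g p)"
    by (subst sum.Sigma)
       (auto simp: case_prod_beta finite_descending_factorizations comp
          finite_splits[of \<gamma>, unfolded case_prod_beta])
  also have "\<dots> = (\<Sum>(\<alpha>, \<beta>) | \<alpha> @ \<beta> = \<gamma>. \<Sum>cs\<in>?F \<alpha>. \<Sum>ds\<in>?F \<beta>. g cs ds)"
    by (rule sum.cong) (auto simp: sum.cartesian_product)
  finally show ?thesis .
qed

theorem theorem2:
  fixes \<gamma> :: "nat list" and n :: nat
  assumes "composition \<gamma>" and "sum_list \<gamma> = n"
  shows "coproduct (powersum \<gamma>) =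
    (\<Sum>(\<alpha>, \<beta>) | \<alpha> @ \<beta> = \<gamma>.
       (\<Prod>i=1..n. fact (count_list \<gamma> i) / (fact (count_list \<alpha> i) * fact (count_list \<beta> i)))
         *\<^sub>Q (powersum \<alpha> \<otimes> powersum \<beta>))"
proof -
  let ?F = descending_factorizations and ?c = "factorization_coeff n" and ?M = "\<lambda>bs. M (map sum_list bs)"
  have comp: "composition (map sum_list bs)" if "bs \<in> ?F \<gamma>" for bs
  proof -
    have "refines \<gamma> (map sum_list bs)"
      using that by (auto simp: descending_factorizations_def refines_def is_refinement_blocks_def)
    then show ?thesis using refines_props(3) assms(1) by blast
  qed
  have "coproduct (powersum \<gamma>) = (\<Sum>bs\<in>?F \<gamma>. ?c bs *\<^sub>Q coproduct (?M bs))"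
    using assms by (simp add: powersum_factorizations[of \<gamma> n] coproduct_sum coproduct_scaleQ)
  \<comment> \<open>Deconcatenating the block sums of \<open>bs\<close> is the same as cutting
    \<open>bs\<close>.\<close>
  also have "\<dots> = (\<Sum>bs\<in>?F \<gamma>. \<Sum>(cs, ds) | cs @ ds = bs. ?c (cs @ ds) *\<^sub>Q (?M cs \<otimes> ?M ds))"
    by (rule sum.cong)
       (auto simp: coproduct_M comp sum_splits_map rat_vector.scale_sum_right intro!: sum.cong)
  also have "\<dots> = (\<Sum>(\<alpha>, \<beta>) | \<alpha> @ \<beta> = \<gamma>. \<Sum>cs\<in>?F \<alpha>. \<Sum>ds\<in>?F \<beta>. ?c (cs @ ds) *\<^sub>Q (?M cs \<otimes> ?M ds))"
    by (rule sum_factorizations_split[OF assms(1)])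
  also have "\<dots> = (\<Sum>(\<alpha>, \<beta>) | \<alpha> @ \<beta> = \<gamma>.
       (\<Prod>i=1..n. fact (count_list \<gamma> i) / (fact (count_list \<alpha> i) * fact (count_list \<beta> i)))
         *\<^sub>Q (powersum \<alpha> \<otimes> powersum \<beta>))"
  proof (rule sum.cong[OF refl], clarify)
    fix \<alpha> \<beta> assume \<gamma>: "\<gamma> = \<alpha> @ \<beta>"
    let ?r = "\<Prod>i=1..n. fact (count_list (\<alpha> @ \<beta>) i) / (fact (count_list \<alpha> i) * fact (count_list \<beta> i)) :: rat"
    have "composition \<alpha>" "composition \<beta>" "sum_list \<alpha> \<le> n" "sum_list \<beta> \<le> n"
      using assms \<gamma> by (auto simp: composition_def)
    then have "powersum \<alpha> \<otimes> powersum \<beta> =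
        (\<Sum>cs\<in>?F \<alpha>. \<Sum>ds\<in>?F \<beta>. (?c cs * ?c ds) *\<^sub>Q (?M cs \<otimes> ?M ds))"
      by (simp only: powersum_factorizations[of _ n] tensor_sum_left)
         (simp add: tensor_sum_right tensor_scaleQ_left tensor_scaleQ_right scaleQ_scaleQ mult.commute)
    \<comment> \<open>The ratio \<open>?r\<close> depends only on \<alpha> and \<beta>, so it leaves
      the inner sums, which then factor as a tensor product.\<close>
    moreover have "?c (cs @ ds) = ?r * (?c cs * ?c ds)" if "cs \<in> ?F \<alpha>" "ds \<in> ?F \<beta>" for cs ds
      using that factorization_coeff_append[of n cs ds]
      by (simp add: descending_factorizations_def)
    ultimately show "(\<Sum>cs\<in>?F \<alpha>. \<Sum>ds\<in>?F \<beta>. ?c (cs @ ds) *\<^sub>Q (?M cs \<otimes> ?M ds)) =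
        ?r *\<^sub>Q (powersum \<alpha> \<otimes> powersum \<beta>)"
      by (simp add: rat_vector.scale_sum_right scaleQ_scaleQ)
  qed
  finally show ?thesis .
qed

end
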